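(* Let $\mathcal{A}=(Q,A,\cdot,\circ)$ be an invertible transducer and put $G=\mathcal{G}(\mathcal{A})$. The following are equivalent: (i) $G$ is finite; (ii) $\mathcal{S}(\partial\mathcal{A})$ is finite; (iii) the cardinalities of all the Schreier graphs on the boundary are uniformly bounded, i.e. there is an integer $n$ such that $\|\mathrm{Sch}(\mathrm{Stab}_G(\underline u),Q\cup Q^{-1})\|\le n$ for all $\underline u\in A^{\omega}$.
   Context: A transducer $\mathcal{A}=(Q,A,\cdot,\circ)$ consists of a finite set $Q$ of states, a finite alphabet $A$, a transition map $(q,a)\mapsto q\cdot a\in Q$ and an output map $(q,a)\mapsto q\circ a\in A$; there is an edge $q\xrightarrow{a|b}p$ iff $q\cdot a=p$, $q\circ a=b$. Each state acts on finite words $A^*$ and right-infinite words $A^\omega$ by $q\circ(a_1a_2\ldots)=(q\circ a_1)((q\cdot a_1)\circ(a_2\ldots))$, and $\mathcal{S}(\mathcal{A})$ is the semigroup generated by these maps on $A^*$. $\mathcal{A}$ is invertible if each $a\mapsto q\circ a$ is a permutation of $A$; then the states generate a group $\mathcal{G}(\mathcal{A})$ of automorphisms of the rooted tree $A^*$, acting also on the boundary $A^\omega$. The dual $\partial\mathcal{A}$ is the transducer with states $A$, alphabet $Q$ and an edge $a\xrightarrow{p|q}b$ for each edge $p\xrightarrow{a|b}q$ of $\mathcal{A}$. For $\underline u\in A^\omega$, $\mathrm{Sch}(\mathrm{Stab}_G(\underline u),Q\cup Q^{-1})$ is identified with the orbital graph of $\underline u$ (vertices: the orbit $G\underline u$;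 an edge labelled $s$ from $\underline w$ to $s(\underline w)$ for each $s\in Q\cup Q^{-1}$), and $\|\cdot\|$ is its number of vertices, i.e. the size of the orbit. *)

theory Defs
  imports "HOL-Algebra.Algebra" "HOL-Library.Stream" "Graph_Theory.Digraph"
begin

section \<open>Transducers\<close>

text \<open>
  The maps \<open>transition\<close> and \<open>out\<close> are total functions on the types; the locale below
  constrains them on \<open>states \<times> alphabet\<close> only, and the semigroup, the group and the
  graphs below depend only on their values there. An edge from \<open>q\<close> to \<open>p\<close> labelled \<open>a|b\<close> means
  \<open>transition T q a = p\<close> and \<open>out T q a = b\<close>.
\<close>

record ('q, 'a) pre_transducer =
  states :: "'q set"
  alphabet :: "'a set"
  transition :: "'q \<Rightarrow> 'a \<Rightarrow> 'q"
  out :: "'q \<Rightarrow> 'a \<Rightarrow> 'a"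

locale transducer =
  fixes T :: "('q, 'a) pre_transducer"
  assumes finite_states: "finite (states T)"
    and finite_alphabet: "finite (alphabet T)"
    and transition_closed: "\<lbrakk>q \<in> states T; a \<in> alphabet T\<rbrakk> \<Longrightarrow> transition T q a \<in> states T"
    and out_closed: "\<lbrakk>q \<in> states T; a \<in> alphabet T\<rbrakk> \<Longrightarrow> out T q a \<in> alphabet T"

locale invertible_transducer = transducer T for T :: "('q, 'a) pre_transducer" +
  assumes out_bij: "q \<in> states T \<Longrightarrow> bij_betw (out T q) (alphabet T) (alphabet T)"

definition dual :: "('q, 'a) pre_transducer \<Rightarrow> ('a, 'q) pre_transducer" where
  "dual T = \<lparr>states = alphabet T, alphabet = states T,
     transition = (\<lambda>a p. out T p a), out = (\<lambda>a p. transition T p a)\<rparr>"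

lemma (in transducer) transducer_dual: "transducer (dual T)"
  by unfold_locales
    (simp_all add: dual_def finite_states finite_alphabet transition_closed out_closed)

primrec word_act :: "('q, 'a) pre_transducer \<Rightarrow> 'q \<Rightarrow> 'a list \<Rightarrow> 'a list" where
  "word_act T q [] = []"
| "word_act T q (a # w) = out T q a # word_act T (transition T q a) w"

primcorec stream_act :: "('q, 'a) pre_transducer \<Rightarrow> 'q \<Rightarrow> 'a stream \<Rightarrow> 'a stream" where
  "shd (stream_act T q u) = out T q (shd u)"
| "stl (stream_act T q u) = stream_act T (transition T q (shd u)) (stl u)"

text \<open>
  The maps on \<open>A\<^sup>*\<close> are kept extensional, so that equality of elements of the semigroup and of
  the group is equality of maps on \<open>A\<^sup>*\<close>.
\<close>

definition state_map :: "('q, 'a) pre_transducer \<Rightarrow> 'q \<Rightarrow> 'a list \<Rightarrow> 'a list" where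
  "state_map T q = restrict (word_act T q) (lists (alphabet T))"

inductive_set transducer_semigroup :: "('q, 'a) pre_transducer \<Rightarrow> ('a list \<Rightarrow> 'a list) set"
  for T :: "('q, 'a) pre_transducer" where
  gen: "q \<in> states T \<Longrightarrow> state_map T q \<in> transducer_semigroup T"
| comp: "\<lbrakk>f \<in> transducer_semigroup T; g \<in> transducer_semigroup T\<rbrakk>
    \<Longrightarrow> compose (lists (alphabet T)) f g \<in> transducer_semigroup T"

definition transducer_group :: "('q, 'a) pre_transducer \<Rightarrow> ('a list \<Rightarrow> 'a list) monoid" where
  "transducer_group T =
     subgroup_generated (BijGroup (lists (alphabet T))) (state_map T ` states T)"


text \<open>The group consists of automorphisms of the rooted tree \<open>A\<^sup>*\<close>.\<close>

definition tree_aut :: "'a set \<Rightarrow> ('a list \<Rightarrow> 'a list) set" where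
  "tree_aut A = {g \<in> Bij (lists A). \<forall>w \<in> lists A. \<forall>n.
     length (g w) = length w \<and> g (take n w) = take n (g w)}"

lemma take_in_lists: "w \<in> lists A \<Longrightarrow> take n w \<in> lists A"
  using set_take_subset[of n w] by (auto simp: in_lists_conv_set)

lemma subgroup_tree_aut: "subgroup (tree_aut A) (BijGroup (lists A))"
proof (rule subgroup.intro)
  show "tree_aut A \<subseteq> carrier (BijGroup (lists A))"
    by (auto simp: tree_aut_def BijGroup_def)
next
  fix f g assume f: "f \<in> tree_aut A" and g: "g \<in> tree_aut A"
  have fB: "f \<in> Bij (lists A)" and gB: "g \<in> Bij (lists A)"
    using f g by (auto simp: tree_aut_def)
  have gL: "g w \<in> lists A" if "w \<in> lists A" for w
    using Bij_imp_funcset[OF gB] that by (rule funcset_mem)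
  have "compose (lists A) f g \<in> tree_aut A"
    unfolding tree_aut_def
  proof (intro CollectI conjI ballI allI compose_Bij fB gB)
    fix w :: "'a list" and n assume w: "w \<in> lists A"
    show "length (compose (lists A) f g w) = length w"
      using f g w gL[OF w] by (simp add: compose_eq tree_aut_def del: in_lists_conv_set)
    show "compose (lists A) f g (take n w) = take n (compose (lists A) f g w)"
      using f g w gL[OF w] take_in_lists[OF w]
      by (simp add: compose_eq tree_aut_def del: in_lists_conv_set)
  qed
  then show "f \<otimes>\<^bsub>BijGroup (lists A)\<^esub> g \<in> tree_aut A"
    using fB gB by (simp add: BijGroup_def)
next
  show "\<one>\<^bsub>BijGroup (lists A)\<^esub> \<in> tree_aut A"
    by (simp add: tree_aut_def BijGroup_def id_Bij take_in_lists del: in_lists_conv_set)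
next
  fix f assume f: "f \<in> tree_aut A"
  then have fB: "f \<in> Bij (lists A)"
    by (auto simp: tree_aut_def)
  then have bij: "bij_betw f (lists A) (lists A)"
    by (simp add: Bij_def)
  define h where "h = inv_into (lists A) f"
  have hL: "h w \<in> lists A" and fh: "f (h w) = w" if "w \<in> lists A" for w
    using Bij_inv_into_mem[OF fB that] bij_betw_inv_into_right[OF bij that]
    by (simp_all add: h_def del: in_lists_conv_set)
  have hf: "h (f w) = w" if "w \<in> lists A" for w
    using bij_betw_inv_into_left[OF bij that] by (simp add: h_def)
  have "restrict h (lists A) \<in> tree_aut A"
    unfolding tree_aut_def
  proof (intro CollectI conjI ballI allI)
    show "restrict h (lists A) \<in> Bij (lists A)"
      unfolding h_def by (rule restrict_inv_into_Bij[OF fB])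
    fix w :: "'a list" and n assume w: "w \<in> lists A"
    have "length (f (h w)) = length (h w)"
      using f hL[OF w] by (auto simp: tree_aut_def)
    then show "length (restrict h (lists A) w) = length w"
      using w fh[OF w] by (simp del: in_lists_conv_set)
    have "f (take n (h w)) = take n w"
      using f hL[OF w] fh[OF w] by (auto simp: tree_aut_def)
    then have "h (take n w) = take n (h w)"
      using hf[OF take_in_lists[OF hL[OF w], of n]] by simp
    then show "restrict h (lists A) (take n w) = take n (restrict h (lists A) w)"
      using w take_in_lists[OF w] by (simp del: in_lists_conv_set)
  qed
  then show "inv\<^bsub>BijGroup (lists A)\<^esub> f \<in> tree_aut A"
    by (simp add: inv_BijGroup[OF fB] h_def)
qed

lemma length_word_act: "length (word_act T q w) = length w"
  by (induction w arbitrary: q) simp_all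

lemma take_word_act: "word_act T q (take n w) = take n (word_act T q w)"
proof (induction w arbitrary: q n)
  case (Cons a w)
  then show ?case by (cases n) simp_all
qed simp

context invertible_transducer
begin

lemma word_act_bij:
  assumes "q \<in> states T"
  shows "bij_betw (word_act T q) (lists (alphabet T)) (lists (alphabet T))"
proof -
  have closed: "word_act T q w \<in> lists (alphabet T)"
    if "w \<in> lists (alphabet T)" "q \<in> states T" for q w
    using that by (induction w arbitrary: q) (auto simp: out_closed transition_closed)
  have inj: "v = w"
    if "v \<in> lists (alphabet T)" "w \<in> lists (alphabet T)" "q \<in> states T"
      "word_act T q v = word_act T q w" for q v w
    using that
  proof (induction v arbitrary: q w rule: list.induct)
    case Nil
    then show ?case by (cases w) simp_all
  next
    case (Cons a v)
    then obtain b w' where w: "w = b # w'"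
      by (cases w) simp_all
    have mem: "a \<in> alphabet T" "b \<in> alphabet T" and "out T q a = out T q b"
      using Cons.prems by (simp_all add: w)
    then have "a = b"
      using inj_onD[OF bij_betw_imp_inj_on[OF out_bij[OF \<open>q \<in> states T\<close>]]] by blast
    with Cons.prems Cons.IH[of w' "transition T q a"] show ?case
      by (simp add: w transition_closed)
  qed
  have surj: "\<exists>v \<in> lists (alphabet T). word_act T q v = w"
    if "w \<in> lists (alphabet T)" "q \<in> states T" for q w
    using that
  proof (induction w arbitrary: q rule: list.induct)
    case Nil
    show ?case by (rule bexI[of _ "[]"]) simp_all
  next
    case (Cons b w)
    then have "b \<in> out T q ` alphabet T"
      using bij_betw_imp_surj_on[OF out_bij[OF \<open>q \<in> states T\<close>]] by simp
    then obtain a where a: "a \<in> alphabet T" "out T q a = b"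
      by blast
    obtain v where "v \<in> lists (alphabet T)" "word_act T (transition T q a) v = w"
      using Cons a(1) transition_closed by auto
    with a show ?case
      by (intro bexI[of _ "a # v"]) simp_all
  qed
  show ?thesis
    unfolding bij_betw_def
  proof
    show "inj_on (word_act T q) (lists (alphabet T))"
      using inj assms by (intro inj_onI) blast
    show "word_act T q ` lists (alphabet T) = lists (alphabet T)"
    proof (intro equalityI subsetI)
      fix w assume "w \<in> word_act T q ` lists (alphabet T)"
      then show "w \<in> lists (alphabet T)"
        using closed[OF _ assms] by (elim imageE) simp
    next
      fix w assume "w \<in> lists (alphabet T)"
      from surj[OF this assms] show "w \<in> word_act T q ` lists (alphabet T)"
        by (elim bexE) (rule image_eqI, simp_all)
    qed
  qed
qed

lemma state_map_tree_aut: "q \<in> states T \<Longrightarrow> state_map T q \<in> tree_aut (alphabet T)"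
  using word_act_bij[of q] take_in_lists[of _ "alphabet T"]
  by (auto simp: tree_aut_def state_map_def Bij_def length_word_act take_word_act
      cong: bij_betw_cong simp del: in_lists_conv_set)

lemma group_transducer_group: "group (transducer_group T)"
  unfolding transducer_group_def by (intro group.group_subgroup_generated group_BijGroup)

lemma carrier_transducer_group:
  "carrier (transducer_group T)
     = generate (BijGroup (lists (alphabet T))) (state_map T ` states T)"
proof -
  have "state_map T ` states T \<subseteq> carrier (BijGroup (lists (alphabet T)))"
    using state_map_tree_aut subgroup.subset[OF subgroup_tree_aut] by blast
  then show ?thesis
    by (simp add: transducer_group_def carrier_subgroup_generated inf.absorb2)
qed

lemma state_map_in_group: "q \<in> states T \<Longrightarrow> state_map T q \<in> carrier (transducer_group T)"
  by (simp add: carrier_transducer_group generate.incl)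

lemma transducer_group_tree_aut: "carrier (transducer_group T) \<subseteq> tree_aut (alphabet T)"
  unfolding carrier_transducer_group
  using state_map_tree_aut
  by (intro group.generate_subgroup_incl[OF group_BijGroup] subgroup_tree_aut) blast

end


section \<open>The action on the boundary\<close>

text \<open>
  An element \<open>g\<close> of the group preserves lengths and prefixes, so it extends uniquely to infinite
  words; on the generators this is \<^const>\<open>stream_act\<close> (lemma \<open>boundary_act_state_map\<close>).
\<close>

definition boundary_act ::
  "('q, 'a) pre_transducer \<Rightarrow> ('a list \<Rightarrow> 'a list) \<Rightarrow> 'a stream \<Rightarrow> 'a stream" where
  "boundary_act T g = (\<lambda>u \<in> streams (alphabet T).
     THE w. w \<in> streams (alphabet T) \<and> (\<forall>n. stake n w = g (stake n u)))"


lemma stake_in_lists: "u \<in> streams A \<Longrightarrow> stake n u \<in> lists A"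
proof (induction n arbitrary: u)
  case (Suc n)
  then show ?case by (cases u) (simp add: streams_Stream)
qed simp

lemma stake_eqI:
  assumes "\<And>n. stake n v = stake n w"
  shows "v = w"
proof -
  have "v !! n = w !! n" for n
    using assms[of "Suc n"] by (simp add: stake_Suc del: stake.simps)
  then show ?thesis
    using smap_alt[of id v w] by (simp add: stream.map_id)
qed

lemma boundary_act_ex1:
  assumes g: "g \<in> tree_aut A" and u: "u \<in> streams A"
  shows "\<exists>!w. w \<in> streams A \<and> (\<forall>n. stake n w = g (stake n u))"
proof (rule ex_ex1I)
  define w where "w = smap (\<lambda>n. g (stake (Suc n) u) ! n) nats"
  have len: "length (g (stake n u)) = n" for n
    using g stake_in_lists[OF u] by (auto simp: tree_aut_def simp del: in_lists_conv_set)
  have pre: "g (take m (stake n u)) = take m (g (stake n u))" for m n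
    using g stake_in_lists[OF u] by (auto simp: tree_aut_def simp del: in_lists_conv_set)
  have w: "stake n w = g (stake n u)" for n
  proof (rule nth_equalityI)
    fix i assume "i < length (stake n w)"
    then have i: "i < n" by simp
    then have "stake (Suc i) u = take (Suc i) (stake n u)"
      by (simp add: take_stake min_def)
    then have "g (stake (Suc i) u) ! i = g (stake n u) ! i"
      by (simp only: pre) simp
    then show "stake n w ! i = g (stake n u) ! i"
      using i by (simp add: w_def del: stake.simps)
  qed (simp add: len)
  have "g (stake n u) \<in> lists A" for n
    using g funcset_mem[OF Bij_imp_funcset stake_in_lists[OF u], of g] by (simp add: tree_aut_def)
  then have "w !! n \<in> A" for n
    using w[of "Suc n"] by (metis in_lists_conv_set length_stake lessI nth_mem stake_nth)
  then have "w \<in> streams A"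
    by (auto simp: streams_iff_sset sset_range)
  with w show "\<exists>w. w \<in> streams A \<and> (\<forall>n. stake n w = g (stake n u))"
    by blast
next
  fix v w
  assume "v \<in> streams A \<and> (\<forall>n. stake n v = g (stake n u))"
    and "w \<in> streams A \<and> (\<forall>n. stake n w = g (stake n u))"
  then show "v = w"
    by (intro stake_eqI) simp
qed

lemma
  assumes "g \<in> tree_aut (alphabet T)" "u \<in> streams (alphabet T)"
  shows boundary_act_in_streams: "boundary_act T g u \<in> streams (alphabet T)"
    and stake_boundary_act: "stake n (boundary_act T g u) = g (stake n u)"
  using theI'[OF boundary_act_ex1[OF assms]] assms by (simp_all add: boundary_act_def)

lemma boundary_act_eqI:
  assumes "g \<in> tree_aut (alphabet T)" "u \<in> streams (alphabet T)"
    and "\<And>n. stake n w = g (stake n u)"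
  shows "boundary_act T g u = w"
  by (rule stake_eqI) (simp add: stake_boundary_act assms)

lemma stake_stream_act: "stake n (stream_act T q u) = word_act T q (stake n u)"
  by (induction n arbitrary: q u) simp_all

context invertible_transducer
begin

lemma boundary_act_state_map:
  assumes "q \<in> states T" "u \<in> streams (alphabet T)"
  shows "boundary_act T (state_map T q) u = stream_act T q u"
  using assms stake_in_lists[OF assms(2)]
  by (intro boundary_act_eqI state_map_tree_aut)
    (simp_all add: stake_stream_act state_map_def del: in_lists_conv_set)

lemma group_action_boundary:
  "group_action (transducer_group T) (streams (alphabet T)) (boundary_act T)"
proof -
  let ?A = "alphabet T" and ?G = "transducer_group T"
  interpret G: group ?G by (rule group_transducer_group)
  have aut: "g \<in> tree_aut ?A" if "g \<in> carrier ?G" for g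
    using that transducer_group_tree_aut by blast
  have mult: "f \<otimes>\<^bsub>?G\<^esub> g = compose (lists ?A) f g"
    if "f \<in> carrier ?G" "g \<in> carrier ?G" for f g
  proof -
    have "f \<in> Bij (lists ?A)" "g \<in> Bij (lists ?A)"
      using that[THEN aut] by (simp_all add: tree_aut_def)
    then show ?thesis
      by (simp add: transducer_group_def BijGroup_def)
  qed
  have one: "\<one>\<^bsub>?G\<^esub> = (\<lambda>w \<in> lists ?A. w)"
    by (simp add: transducer_group_def BijGroup_def)
  have act_mult: "boundary_act T (f \<otimes>\<^bsub>?G\<^esub> g) u = boundary_act T f (boundary_act T g u)"
    if f: "f \<in> carrier ?G" and g: "g \<in> carrier ?G" and u: "u \<in> streams ?A" for f g u
    using stake_in_lists[OF u]
    by (intro boundary_act_eqI aut G.m_closed f g u)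
      (simp add: mult f g u aut stake_boundary_act boundary_act_in_streams compose_eq
        del: in_lists_conv_set)
  have act_one: "boundary_act T \<one>\<^bsub>?G\<^esub> u = u" if "u \<in> streams ?A" for u
    using stake_in_lists[OF that]
    by (intro boundary_act_eqI aut G.one_closed that) (simp add: one del: in_lists_conv_set)
  have Bij: "boundary_act T g \<in> Bij (streams ?A)" if g: "g \<in> carrier ?G" for g
    unfolding Bij_def
  proof
    show "boundary_act T g \<in> extensional (streams ?A)"
      by (simp add: boundary_act_def)
    have "bij_betw (boundary_act T g) (streams ?A) (streams ?A)"
    proof (rule bij_betw_byWitness[where f' = "boundary_act T (inv\<^bsub>?G\<^esub> g)"])
      show "\<forall>u \<in> streams ?A. boundary_act T (inv\<^bsub>?G\<^esub> g) (boundary_act T g u) = u"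
        using g by (simp flip: act_mult add: act_one)
      show "\<forall>u \<in> streams ?A. boundary_act T g (boundary_act T (inv\<^bsub>?G\<^esub> g) u) = u"
        using g by (simp flip: act_mult add: act_one)
    qed (use g aut boundary_act_in_streams in blast)+
    then show "boundary_act T g \<in> {f. bij_betw f (streams ?A) (streams ?A)}"
      by simp
  qed
  have "boundary_act T \<in> hom ?G (BijGroup (streams ?A))"
  proof (rule homI)
    fix f g assume f: "f \<in> carrier ?G" and g: "g \<in> carrier ?G"
    have "boundary_act T (f \<otimes>\<^bsub>?G\<^esub> g) = compose (streams ?A) (boundary_act T f) (boundary_act T g)"
    proof (rule extensionalityI)
      show "boundary_act T (f \<otimes>\<^bsub>?G\<^esub> g) \<in> extensional (streams ?A)"
        by (simp add: boundary_act_def)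
    qed (simp_all add: compose_eq act_mult f g)
    then show "boundary_act T (f \<otimes>\<^bsub>?G\<^esub> g)
        = boundary_act T f \<otimes>\<^bsub>BijGroup (streams ?A)\<^esub> boundary_act T g"
      using f g by (simp add: BijGroup_def Bij)
  qed (simp add: BijGroup_def Bij)
  then show ?thesis
    by (intro group_action.intro group_hom.intro group_hom_axioms.intro
        group_BijGroup G.is_group)
qed

end


section \<open>Schreier graphs\<close>

text \<open>
  Groups act on the left, so the vertices of \<open>Sch(H, I)\<close> are the left cosets \<open>gH\<close>, with an edge
  labelled \<open>i\<close> from \<open>gH\<close> to \<open>\<sigma>(i)gH\<close>. The set \<open>I\<close> consists of symbols, evaluated in the group
  by \<open>\<sigma>\<close>: distinct states may well define the same group element.
\<close>

definition schreier_graph ::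
  "('g, 'm) monoid_scheme \<Rightarrow> 'g set \<Rightarrow> 'i set \<Rightarrow> ('i \<Rightarrow> 'g)
     \<Rightarrow> ('g set, 'g set \<times> 'i \<times> 'g set) pre_digraph" where
  "schreier_graph G H I \<sigma> =
     \<lparr>verts = lcosets\<^bsub>G\<^esub> H,
      arcs = {(C, i, \<sigma> i <#\<^bsub>G\<^esub> C) | C i. C \<in> lcosets\<^bsub>G\<^esub> H \<and> i \<in> I},
      tail = (\<lambda>(C, i, D). C), head = (\<lambda>(C, i, D). D)\<rparr>"

definition orbital_graph ::
  "('g, 'm) monoid_scheme \<Rightarrow> ('g \<Rightarrow> 'x \<Rightarrow> 'x) \<Rightarrow> 'x \<Rightarrow> 'i set \<Rightarrow> ('i \<Rightarrow> 'g)
     \<Rightarrow> ('x, 'x \<times> 'i \<times> 'x) pre_digraph" where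
  "orbital_graph G \<phi> x I \<sigma> =
     \<lparr>verts = orbit G \<phi> x,
      arcs = {(y, i, \<phi> (\<sigma> i) y) | y i. y \<in> orbit G \<phi> x \<and> i \<in> I},
      tail = (\<lambda>(y, i, z). y), head = (\<lambda>(y, i, z). z)\<rparr>"

text \<open>
  The coset graph of a stabilizer is isomorphic to the orbital graph, the vertex \<open>g Stab(x)\<close>
  corresponding to the point \<open>g x\<close>.
\<close>

lemma (in group_action) schreier_graph_iso_orbital_graph:
  assumes x: "x \<in> E" and \<sigma>: "\<And>i. i \<in> I \<Longrightarrow> \<sigma> i \<in> carrier G"
  defines "H \<equiv> stabilizer G \<phi> x"
  obtains f where
    "\<And>g. g \<in> carrier G \<Longrightarrow> f (g <#\<^bsub>G\<^esub> H) = \<phi> g x"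
    "bij_betw f (verts (schreier_graph G H I \<sigma>)) (verts (orbital_graph G \<phi> x I \<sigma>))"
    "arcs (orbital_graph G \<phi> x I \<sigma>)
       = (\<lambda>(C, i, D). (f C, i, f D)) ` arcs (schreier_graph G H I \<sigma>)"
proof -
  interpret group G
    using group_hom by (simp add: group_hom_def)
  interpret H: subgroup H G
    unfolding H_def by (rule stabilizer_subgroup[OF x])
  define f where "f C = (THE y. \<forall>g \<in> C. \<phi> g x = y)" for C
  have img: "\<phi> g' x = \<phi> g x" if "g \<in> carrier G" "g' \<in> g <# H" for g g'
  proof -
    from that(2) obtain h where h: "h \<in> H" and g': "g' = g \<otimes> h"
      unfolding l_coset_def by blast
    from h have "\<phi> h x = x" "h \<in> carrier G"
      unfolding H_def stabilizer_def by blast+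
    then show ?thesis
      using composition_rule[OF x that(1)] by (simp add: g')
  qed
  have f: "f (g <# H) = \<phi> g x" if g: "g \<in> carrier G" for g
    unfolding f_def
  proof (rule the_equality)
    show "\<forall>g' \<in> g <# H. \<phi> g' x = \<phi> g x"
      using img[OF g] by blast
  next
    fix y assume "\<forall>g' \<in> g <# H. \<phi> g' x = y"
    then show "y = \<phi> g x"
      using lcos_self[OF g H.subgroup_axioms] by (metis bspec)
  qed
  have eq: "g <# H = g' <# H"
    if g: "g \<in> carrier G" and g': "g' \<in> carrier G" and e: "\<phi> g x = \<phi> g' x" for g g'
  proof -
    have "\<phi> (inv g \<otimes> g') x = x"
      using composition_rule[OF x inv_closed[OF g] g'] orbit_sym_aux[OF g x e] by simp
    then have "inv g \<otimes> g' \<in> H"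
      unfolding H_def stabilizer_def using g g' by blast
    then have "g' \<in> g <# H"
      by (rule H.lcos_module_rev[OF is_group g g'])
    then show ?thesis
      by (rule l_repr_independence[OF _ g H.subgroup_axioms])
  qed
  have V: "lcosets H = (\<lambda>g. g <# H) ` carrier G"
    by (auto simp: LCOSETS_def)
  have O: "orbit G \<phi> x = (\<lambda>g. \<phi> g x) ` carrier G"
    by (auto simp: orbit_def)
  have bij: "bij_betw f (verts (schreier_graph G H I \<sigma>)) (verts (orbital_graph G \<phi> x I \<sigma>))"
    unfolding bij_betw_def
  proof
    have "inj_on f ((\<lambda>g. g <# H) ` carrier G)"
    proof (intro inj_onI, elim imageE)
      fix C D g g'
      assume "f C = f D" and C: "C = g <# H" and D: "D = g' <# H"
        and g: "g \<in> carrier G" and g': "g' \<in> carrier G"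
      then have "\<phi> g x = \<phi> g' x"
        using f[OF g] f[OF g'] by simp
      then show "C = D"
        unfolding C D by (rule eq[OF g g'])
    qed
    then show "inj_on f (verts (schreier_graph G H I \<sigma>))"
      by (simp only: schreier_graph_def V pre_digraph.select_convs)
    have "f ` (\<lambda>g. g <# H) ` carrier G = (\<lambda>g. \<phi> g x) ` carrier G"
      unfolding image_image by (rule image_cong[OF refl f])
    then show "f ` verts (schreier_graph G H I \<sigma>) = verts (orbital_graph G \<phi> x I \<sigma>)"
      by (simp only: schreier_graph_def orbital_graph_def V O pre_digraph.select_convs)
  qed
  have mult: "\<sigma> i <# (g <# H) = (\<sigma> i \<otimes> g) <# H" if "i \<in> I" "g \<in> carrier G" for i g
    by (rule lcos_m_assoc[OF H.subset \<sigma>[OF that(1)] that(2)])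
  have S: "arcs (schreier_graph G H I \<sigma>)
      = (\<lambda>(g, i). (g <# H, i, (\<sigma> i \<otimes> g) <# H)) ` (carrier G \<times> I)"
  proof -
    have "arcs (schreier_graph G H I \<sigma>) = {(g <# H, i, \<sigma> i <# (g <# H)) | g i. g \<in> carrier G \<and> i \<in> I}"
      unfolding schreier_graph_def V by fastforce
    also have "\<dots> = {(g <# H, i, (\<sigma> i \<otimes> g) <# H) | g i. g \<in> carrier G \<and> i \<in> I}"
      by (intro Collect_cong ex_cong1) (auto simp: mult)
    finally show ?thesis
      by fastforce
  qed
  have "arcs (orbital_graph G \<phi> x I \<sigma>) = {(\<phi> g x, i, \<phi> (\<sigma> i) (\<phi> g x)) | g i. g \<in> carrier G \<and> i \<in> I}"
    unfolding orbital_graph_def O by fastforce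
  also have "\<dots> = {(\<phi> g x, i, \<phi> (\<sigma> i \<otimes> g) x) | g i. g \<in> carrier G \<and> i \<in> I}"
    by (intro Collect_cong ex_cong1) (auto simp: composition_rule[OF x \<sigma>])
  also have "\<dots> = (\<lambda>(g, i). (\<phi> g x, i, \<phi> (\<sigma> i \<otimes> g) x)) ` (carrier G \<times> I)"
    by fastforce
  also have "\<dots> = (\<lambda>(C, i, D). (f C, i, f D)) ` arcs (schreier_graph G H I \<sigma>)"
    unfolding S image_image by (intro image_cong) (auto simp: f \<sigma>)
  finally show thesis
    using that f bij by blast
qed

text \<open>The symbols \<open>Q \<union> Q\<^sup>-\<^sup>1\<close>: \<open>Inl q\<close> stands for \<open>q\<close> and \<open>Inr q\<close> for its formal inverse.\<close>

definition signed_states :: "('q, 'a) pre_transducer \<Rightarrow> ('q + 'q) set" where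
  "signed_states T = states T <+> states T"

definition signed_map :: "('q, 'a) pre_transducer \<Rightarrow> 'q + 'q \<Rightarrow> 'a list \<Rightarrow> 'a list" where
  "signed_map T = case_sum (state_map T) (\<lambda>q. inv\<^bsub>transducer_group T\<^esub> (state_map T q))"

definition boundary_schreier_graph ::
  "('q, 'a) pre_transducer \<Rightarrow> 'a stream
     \<Rightarrow> (('a list \<Rightarrow> 'a list) set,
         ('a list \<Rightarrow> 'a list) set \<times> ('q + 'q) \<times> ('a list \<Rightarrow> 'a list) set) pre_digraph" where
  "boundary_schreier_graph T u =
     schreier_graph (transducer_group T)
       (stabilizer (transducer_group T) (boundary_act T) u)
       (signed_states T) (signed_map T)"

lemma (in invertible_transducer) boundary_schreier_graph_verts:
  assumes "u \<in> streams (alphabet T)"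
  obtains f where
    "bij_betw f (verts (boundary_schreier_graph T u))
       (orbit (transducer_group T) (boundary_act T) u)"
proof -
  interpret group_action "transducer_group T" "streams (alphabet T)" "boundary_act T"
    by (rule group_action_boundary)
  interpret G: group "transducer_group T" by (rule group_transducer_group)
  have "signed_map T i \<in> carrier (transducer_group T)" if "i \<in> signed_states T" for i
    using that by (auto simp: signed_map_def signed_states_def state_map_in_group)
  then obtain f where f: "bij_betw f
      (verts (schreier_graph (transducer_group T)
        (stabilizer (transducer_group T) (boundary_act T) u) (signed_states T) (signed_map T)))
      (verts (orbital_graph (transducer_group T) (boundary_act T) u
        (signed_states T) (signed_map T)))"
    by (rule schreier_graph_iso_orbital_graph[OF assms])
  show thesis
    by (rule that[of f])
      (use f in \<open>simp only: boundary_schreier_graph_def orbital_graph_def pre_digraph.select_convs\<close>)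
qed

end

theory Submission
  imports Defs
begin

text \<open>
  Everything is reduced to the finiteness of the monoid of maps of \<open>A\<^sup>*\<close> that are given by words
  over \<open>Q\<close>, that is, of the semigroup \<open>\<S>(\<A>)\<close> with the identity adjoined.

  For (i) \<open>\<longleftrightarrow>\<close> (ii), the action of \<open>u \<in> A\<^sup>*\<close> on \<open>Q\<^sup>*\<close> in the dual reads a word \<open>p\<^sub>1\<dots>p\<^sub>n\<close> and
  outputs at position \<open>i\<close> the state reached from \<open>p\<^sub>i\<close> by reading \<open>g(u)\<close>, where \<open>g\<close> is the map
  given by the prefix \<open>p\<^sub>1\<dots>p\<^bsub>i-1\<^esub>\<close>. Hence this action is determined by the function \<open>(p, g) \<mapsto> p \<cdot> g(u)\<close>
  on \<open>Q\<close> times the monoid, with values in \<open>Q\<close>. If the monoid is finite, there are only finitely many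
  such functions, and so the dual monoid is finite (lemma \<open>finite_dual_word_maps\<close>). Dualising twice
  gives back the transducer, so the implication reverses. Finally, a finite monoid inside a group
  is a subgroup, so the monoid is finite if and only if the group generated by the states is
  (lemma \<open>finite_group_iff_finite_word_maps\<close>).

  For (iii), orbits of a finite group \<open>G\<close> have at most \<open>|G|\<close> points. Conversely, let all orbits have
  at most \<open>n\<close> points. Numbering the points of an orbit turns the action of the states on it into
  a family of self-maps of \<open>{0, \<dots>, n-1}\<close> indexed by \<open>Q\<close>. There are only finitely many such
  families, and two words over \<open>Q\<close> that evaluate alike in each of them move every point of every
  orbit alike (lemma \<open>finite_word_actions_if_bounded_invariant_sets\<close>). So the words over \<open>Q\<close> induce
  only finitely many maps on the boundary, and a map on the boundary determines the map on
  finite words.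
\<close>

section \<open>Finiteness principles\<close>

text \<open>The values of \<open>f\<close> are indexed by the codes \<open>\<Phi> x\<close>.\<close>

lemma finite_image_if_determined:
  assumes "finite (\<Phi> ` S)"
    and "\<And>x y. \<lbrakk>x \<in> S; y \<in> S; \<Phi> x = \<Phi> y\<rbrakk> \<Longrightarrow> f x = f y"
  shows "finite (f ` S)"
proof -
  have "f ` S \<subseteq> (\<lambda>z. f (inv_into S \<Phi> z)) ` \<Phi> ` S"
  proof
    fix y assume "y \<in> f ` S"
    then obtain x where x: "x \<in> S" "y = f x"
      by blast
    then have "f (inv_into S \<Phi> (\<Phi> x)) = f x"
      by (intro assms(2)) (auto simp: inv_into_into f_inv_into_f)
    then show "y \<in> (\<lambda>z. f (inv_into S \<Phi> z)) ` \<Phi> ` S"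
      using x by (metis imageI)
  qed
  then show ?thesis
    using assms(1) finite_surj by blast
qed

lemma (in group) subgroup_if_finite_submonoid:
  assumes "submonoid H G" and "finite H"
  shows "subgroup H G"
proof (rule subgroupI)
  interpret H: submonoid H G by fact
  show "H \<subseteq> carrier G"
    by (rule H.subset)
  show "H \<noteq> {}"
    using H.one_closed by blast
  show "a \<otimes> b \<in> H" if "a \<in> H" "b \<in> H" for a b
    using that by simp
  show "inv a \<in> H" if a: "a \<in> H" for a
  proof -
    \<comment> \<open>Right translation by \<open>a\<close> is injective on the finite set \<open>H\<close>, hence reaches \<open>\<one>\<close>.\<close>
    have "inj_on (\<lambda>x. x \<otimes> a) H"
      using a H.subset by (intro inj_onI) (metis r_cancel subsetD)
    then have "(\<lambda>x. x \<otimes> a) ` H = H"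
      using a by (intro endo_inj_surj \<open>finite H\<close>) auto
    then obtain x where x: "x \<in> H" "x \<otimes> a = \<one>"
      using H.one_closed by (metis imageE)
    then have "inv a = x"
      using a H.subset by (intro inv_equality) auto
    with x show ?thesis
      by simp
  qed
qed

text \<open>
  The maps \<open>t q\<close> on an invariant set with at most \<open>n\<close> points are conjugate to self-maps of
  \<open>{..<n}\<close>. A word is therefore determined on \<open>E\<close> by its values on the finitely many families
  of self-maps of \<open>{..<n}\<close>; the invariant sets themselves may be infinite in number.
\<close>

lemma finite_word_actions_if_bounded_invariant_sets:
  fixes t :: "'q \<Rightarrow> 'x \<Rightarrow> 'x" and n :: nat
  assumes "finite Q"
    and inv: "\<And>x. x \<in> E \<Longrightarrow>
      \<exists>Y. x \<in> Y \<and> finite Y \<and> card Y \<le> n \<and> (\<forall>q \<in> Q. \<forall>y \<in> Y. t q y \<in> Y)"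
  shows "finite ((\<lambda>ws. restrict (fold t ws) E) ` lists Q)"
proof (rule finite_image_if_determined)
  let ?N = "{..<n}"
  let ?F = "Q \<rightarrow>\<^sub>E (?N \<rightarrow>\<^sub>E ?N)"
  define \<Phi> where "\<Phi> ws = (\<lambda>(\<sigma>, i) \<in> ?F \<times> ?N. fold \<sigma> ws i)" for ws
  have closed: "fold \<sigma> ws i \<in> ?N" if "\<sigma> \<in> ?F" "i \<in> ?N" "ws \<in> lists Q" for \<sigma> ws i
    using that(3,2)
  proof (induction ws arbitrary: i rule: lists.induct)
    case (Cons q ws)
    then have "\<sigma> q i \<in> ?N"
      using that(1) by (meson PiE_mem)
    with Cons show ?case
      by simp
  qed simp
  have "finite ?F"
    using \<open>finite Q\<close> by (intro finite_PiE) auto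
  then have "finite ((?F \<times> ?N) \<rightarrow>\<^sub>E ?N)"
    by (intro finite_PiE) auto
  moreover have "\<Phi> ` lists Q \<subseteq> (?F \<times> ?N) \<rightarrow>\<^sub>E ?N"
    unfolding \<Phi>_def
    by (intro image_subsetI restrict_PiE_iff[THEN iffD2] ballI, elim SigmaE)
      (simp only: prod.case closed)
  ultimately show "finite (\<Phi> ` lists Q)"
    by (rule finite_subset[rotated])
  fix vs ws assume vs: "vs \<in> lists Q" and ws: "ws \<in> lists Q" and eq: "\<Phi> vs = \<Phi> ws"
  have "fold t vs x = fold t ws x" if x: "x \<in> E" for x
  proof -
    obtain Y where Y: "x \<in> Y" "finite Y" "card Y \<le> n" "\<And>q y. \<lbrakk>q \<in> Q; y \<in> Y\<rbrakk> \<Longrightarrow> t q y \<in> Y"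
      using inv[OF x] by blast
    obtain f where f: "inj_on f Y" "f ` Y \<subseteq> ?N"
      using card_le_inj[OF Y(2), of ?N] Y(3) by auto
    \<comment> \<open>\<open>\<sigma> q\<close> is \<open>t q\<close> transported along \<open>f\<close>; off the image of \<open>Y\<close> any value below \<open>n\<close> would do.\<close>
    define \<sigma> where
      "\<sigma> = (\<lambda>q \<in> Q. \<lambda>i \<in> ?N. if i \<in> f ` Y then f (t q (inv_into Y f i)) else i)"
    have \<sigma>: "\<sigma> \<in> ?F"
    proof -
      have "f (t q (inv_into Y f i)) \<in> ?N" if "q \<in> Q" "i \<in> f ` Y" for q i
        using f(2) Y(4)[OF that(1) inv_into_into[OF that(2)]] by blast
      then show ?thesis
        unfolding \<sigma>_def restrict_PiE_iff by simp
    qed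
    have step: "\<sigma> q (f y) = f (t q y)" if "q \<in> Q" "y \<in> Y" for q y
    proof -
      have "f y \<in> ?N"
        using f(2) that(2) by blast
      then show ?thesis
        using that by (simp add: \<sigma>_def inv_into_f_f[OF f(1)])
    qed
    have conj: "fold \<sigma> us (f y) = f (fold t us y) \<and> fold t us y \<in> Y"
      if "us \<in> lists Q" "y \<in> Y" for us y
      using that by (induction us arbitrary: y rule: lists.induct) (auto simp: step Y(4))
    have "f x \<in> ?N"
      using f(2) Y(1) by blast
    then have "fold \<sigma> vs (f x) = fold \<sigma> ws (f x)"
      using fun_cong[OF eq, of "(\<sigma>, f x)"] \<sigma> by (simp add: \<Phi>_def del: lessThan_iff)
    then show ?thesis
      using conj[OF vs Y(1)] conj[OF ws Y(1)] f(1) by (auto dest: inj_onD)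
  qed
  then show "restrict (fold t vs) E = restrict (fold t ws) E"
    by (intro restrict_ext)
qed


section \<open>The monoid of maps given by words of states\<close>

text \<open>
  The first letter of a word acts first. This is the order in which the dual transducer, reading the
  word from left to right, applies its letters.
\<close>

definition word_map :: "('q, 'a) pre_transducer \<Rightarrow> 'q list \<Rightarrow> 'a list \<Rightarrow> 'a list" where
  "word_map T ws = restrict (fold (word_act T) ws) (lists (alphabet T))"

definition word_maps :: "('q, 'a) pre_transducer \<Rightarrow> ('a list \<Rightarrow> 'a list) set" where
  "word_maps T = word_map T ` lists (states T)"

lemma word_map_Nil: "word_map T [] = (\<lambda>u \<in> lists (alphabet T). u)"
  by (auto simp: word_map_def)

lemma word_map_singleton: "word_map T [q] = state_map T q"
  by (simp add: word_map_def state_map_def)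

context transducer
begin

lemma word_act_closed:
  "\<lbrakk>q \<in> states T; u \<in> lists (alphabet T)\<rbrakk> \<Longrightarrow> word_act T q u \<in> lists (alphabet T)"
  by (induction u arbitrary: q) (auto simp: out_closed transition_closed)

lemma fold_word_act_closed:
  "\<lbrakk>ws \<in> lists (states T); u \<in> lists (alphabet T)\<rbrakk>
    \<Longrightarrow> fold (word_act T) ws u \<in> lists (alphabet T)"
  by (induction ws arbitrary: u) (auto simp: word_act_closed simp del: in_lists_conv_set)

lemma foldl_transition_closed:
  "\<lbrakk>q \<in> states T; u \<in> lists (alphabet T)\<rbrakk> \<Longrightarrow> foldl (transition T) q u \<in> states T"
  by (induction u arbitrary: q) (auto simp: transition_closed)

lemma word_map_append:
  assumes "vs \<in> lists (states T)"
  shows "word_map T (vs @ ws) = compose (lists (alphabet T)) (word_map T ws) (word_map T vs)"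
  using fold_word_act_closed[OF assms]
  by (auto simp: word_map_def compose_def fun_eq_iff simp del: in_lists_conv_set)

lemma compose_word_maps:
  assumes "f \<in> word_maps T" "g \<in> word_maps T"
  shows "compose (lists (alphabet T)) f g \<in> word_maps T"
proof -
  obtain vs ws where "vs \<in> lists (states T)" and f: "f = word_map T vs"
    and ws: "ws \<in> lists (states T)" and g: "g = word_map T ws"
    using assms unfolding word_maps_def by blast
  then have "ws @ vs \<in> lists (states T)"
    by simp
  then show ?thesis
    unfolding f g word_maps_def word_map_append[OF ws, symmetric] by (rule imageI)
qed

lemma state_map_in_word_maps: "q \<in> states T \<Longrightarrow> state_map T q \<in> word_maps T"
  by (auto simp: word_maps_def simp flip: word_map_singleton)

lemma word_maps_eq_semigroup:
  "word_maps T = insert (\<lambda>u \<in> lists (alphabet T). u) (transducer_semigroup T)"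
proof (intro equalityI subsetI)
  fix f assume "f \<in> word_maps T"
  then obtain ws where ws: "ws \<in> lists (states T)" and f: "f = word_map T ws"
    unfolding word_maps_def by blast
  from ws have "ws = [] \<or> word_map T ws \<in> transducer_semigroup T"
  proof (induction ws rule: lists.induct)
    case (Cons q ws)
    show ?case
    proof (cases "ws = []")
      case True
      with Cons show ?thesis
        by (simp add: word_map_singleton transducer_semigroup.gen)
    next
      case False
      with Cons have "word_map T ws \<in> transducer_semigroup T"
        by blast
      with Cons have "compose (lists (alphabet T)) (word_map T ws) (state_map T q)
          \<in> transducer_semigroup T"
        by (intro transducer_semigroup.intros)
      then show ?thesis
        using word_map_append[of "[q]" ws] Cons.hyps(1) by (simp add: word_map_singleton)
    qed
  qed simp
  then show "f \<in> insert (\<lambda>u \<in> lists (alphabet T). u) (transducer_semigroup T)"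
    by (auto simp: f word_map_Nil simp del: in_lists_conv_set)
next
  fix f assume "f \<in> insert (\<lambda>u \<in> lists (alphabet T). u) (transducer_semigroup T)"
  moreover have "f \<in> word_maps T" if "f \<in> transducer_semigroup T"
    using that by induction (auto intro: state_map_in_word_maps compose_word_maps)
  moreover have "(\<lambda>u \<in> lists (alphabet T). u) \<in> word_maps T"
    unfolding word_maps_def word_map_Nil[symmetric] by (rule imageI) simp
  ultimately show "f \<in> word_maps T"
    by blast
qed

lemma finite_word_maps_iff: "finite (word_maps T) \<longleftrightarrow> finite (transducer_semigroup T)"
  by (simp add: word_maps_eq_semigroup)

end


section \<open>Duality\<close>

lemma dual_dual: "dual (dual T) = T"
  by (simp add: dual_def)

text \<open>
  In the cross diagram with \<open>p\<close> followed by \<open>ws\<close> on one side and \<open>u\<close> on the other, the first output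
  state is \<open>p \<cdot> u\<close>, while the remaining states \<open>ws\<close> are met by \<open>p \<circ> u\<close> instead of \<open>u\<close>.
\<close>

lemma fold_dual_Cons:
  "fold (word_act (dual T)) u (p # ws) =
     foldl (transition T) p u # fold (word_act (dual T)) (word_act T p u) ws"
  by (induction u arbitrary: p ws) (simp_all add: dual_def)

lemma fold_word_act_Nil: "fold (word_act T) ws [] = []"
  by (induction ws) simp_all

lemma dual_action_determined:
  assumes "ws \<in> lists Q"
    and "\<And>p vs. \<lbrakk>p \<in> Q; vs \<in> lists Q\<rbrakk> \<Longrightarrow> foldl (transition T) p (fold (word_act T) vs u)
      = foldl (transition T) p (fold (word_act T) vs v)"
  shows "fold (word_act (dual T)) u ws = fold (word_act (dual T)) v ws"
  using assms
proof (induction ws arbitrary: u v rule: lists.induct)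
  case Nil
  show ?case
    by (simp only: fold_word_act_Nil)
next
  case (Cons p ws)
  have "foldl (transition T) p u = foldl (transition T) p v"
    using Cons.prems[of p "[]"] \<open>p \<in> Q\<close> by simp
  moreover have "fold (word_act (dual T)) (word_act T p u) ws
      = fold (word_act (dual T)) (word_act T p v) ws"
  proof (rule Cons.IH)
    fix r vs assume "r \<in> Q" "vs \<in> lists Q"
    then show "foldl (transition T) r (fold (word_act T) vs (word_act T p u))
        = foldl (transition T) r (fold (word_act T) vs (word_act T p v))"
      using Cons.prems[of r "p # vs"] \<open>p \<in> Q\<close> by simp
  qed
  ultimately show ?case
    by (simp only: fold_dual_Cons)
qed

context transducer
begin

text \<open>
  The action of \<open>u\<close> in the dual depends only on the function \<open>(p, g) \<mapsto> p \<cdot> g(u)\<close>, an element of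
  a finite set as soon as the monoid of the maps \<open>g\<close> is finite.
\<close>

lemma finite_dual_word_maps:
  assumes "finite (word_maps T)"
  shows "finite (word_maps (dual T))"
proof -
  let ?A = "alphabet T" and ?Q = "states T"
  define \<Phi> where "\<Phi> u = (\<lambda>(p, g) \<in> ?Q \<times> word_maps T. foldl (transition T) p (g u))" for u
  have "finite (word_map (dual T) ` lists ?A)"
  proof (rule finite_image_if_determined)
    have "g u \<in> lists ?A" if "g \<in> word_maps T" "u \<in> lists ?A" for g u
    proof -
      obtain ws where "ws \<in> lists ?Q" "g = word_map T ws"
        using \<open>g \<in> word_maps T\<close> unfolding word_maps_def by blast
      then show ?thesis
        using fold_word_act_closed \<open>u \<in> lists ?A\<close>
        by (simp add: word_map_def del: in_lists_conv_set)
    qed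
    then have "\<Phi> ` lists ?A \<subseteq> (?Q \<times> word_maps T) \<rightarrow>\<^sub>E ?Q"
      unfolding \<Phi>_def
      by (intro image_subsetI restrict_PiE_iff[THEN iffD2] ballI, elim SigmaE)
        (simp only: prod.case foldl_transition_closed)
    moreover have "finite ((?Q \<times> word_maps T) \<rightarrow>\<^sub>E ?Q)"
      by (intro finite_PiE finite_cartesian_product finite_states assms)
    ultimately show "finite (\<Phi> ` lists ?A)"
      by (rule finite_subset)
    fix u v assume u: "u \<in> lists ?A" and v: "v \<in> lists ?A" and eq: "\<Phi> u = \<Phi> v"
    have "foldl (transition T) p (fold (word_act T) vs u)
        = foldl (transition T) p (fold (word_act T) vs v)"
      if "p \<in> ?Q" "vs \<in> lists ?Q" for p vs
    proof -
      have "word_map T vs \<in> word_maps T"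
        using that(2) unfolding word_maps_def by (rule imageI)
      then show ?thesis
        using fun_cong[OF eq, of "(p, word_map T vs)"] that(1) u v
        by (simp add: \<Phi>_def word_map_def del: in_lists_conv_set)
    qed
    then have "fold (word_act (dual T)) u ws = fold (word_act (dual T)) v ws"
      if "ws \<in> lists ?Q" for ws
      by (rule dual_action_determined[OF that])
    then show "word_map (dual T) u = word_map (dual T) v"
      unfolding word_map_def by (intro restrict_ext) (simp add: dual_def)
  qed
  then show ?thesis
    by (simp add: word_maps_def dual_def)
qed

lemma finite_dual_word_maps_iff: "finite (word_maps (dual T)) \<longleftrightarrow> finite (word_maps T)"
  using finite_dual_word_maps transducer.finite_dual_word_maps[OF transducer_dual]
  by (auto simp: dual_dual)

end


section \<open>The group and its orbits on the boundary\<close>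

context invertible_transducer
begin

lemma submonoid_word_maps: "submonoid (word_maps T) (BijGroup (lists (alphabet T)))"
proof -
  let ?L = "lists (alphabet T)"
  have Bij: "word_map T ws \<in> Bij ?L" if "ws \<in> lists (states T)" for ws
    using that
  proof (induction ws rule: lists.induct)
    case Nil
    show ?case
      by (simp only: word_map_Nil id_Bij)
  next
    case (Cons q ws)
    have "state_map T q \<in> Bij ?L"
      using state_map_tree_aut[OF Cons.hyps(1)] by (simp add: tree_aut_def)
    then show ?case
      using Cons word_map_append[of "[q]" ws] by (simp add: word_map_singleton compose_Bij)
  qed
  then have sub: "word_maps T \<subseteq> Bij ?L"
    by (auto simp: word_maps_def simp del: in_lists_conv_set)
  show ?thesis
  proof
    show "word_maps T \<subseteq> carrier (BijGroup ?L)"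
      using sub by (simp add: BijGroup_def)
    show "f \<otimes>\<^bsub>BijGroup ?L\<^esub> g \<in> word_maps T" if "f \<in> word_maps T" "g \<in> word_maps T" for f g
      using that sub compose_word_maps[OF that] by (auto simp: BijGroup_def)
    show "\<one>\<^bsub>BijGroup ?L\<^esub> \<in> word_maps T"
      by (simp add: BijGroup_def word_maps_eq_semigroup)
  qed
qed

lemma finite_group_iff_finite_word_maps:
  "finite (carrier (transducer_group T)) \<longleftrightarrow> finite (word_maps T)"
proof
  let ?B = "BijGroup (lists (alphabet T))"
  interpret B: group ?B by (rule group_BijGroup)
  have gens: "state_map T ` states T \<subseteq> word_maps T"
    using state_map_in_word_maps by blast
  show "finite (carrier (transducer_group T))" if fin: "finite (word_maps T)"
  proof -
    have "subgroup (word_maps T) ?B"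
      by (rule B.subgroup_if_finite_submonoid[OF submonoid_word_maps fin])
    then have "carrier (transducer_group T) \<subseteq> word_maps T"
      unfolding carrier_transducer_group by (rule B.generate_subgroup_incl[OF gens])
    then show ?thesis
      by (rule finite_subset[OF _ fin])
  qed
  show "finite (word_maps T)" if fin: "finite (carrier (transducer_group T))"
  proof -
    interpret G: group "transducer_group T" by (rule group_transducer_group)
    have Bij: "f \<in> Bij (lists (alphabet T))" if "f \<in> carrier (transducer_group T)" for f
      using that transducer_group_tree_aut by (auto simp: tree_aut_def)
    have "f \<in> carrier (transducer_group T)" if "f \<in> transducer_semigroup T" for f
      using that
    proof induction
      case (comp f g)
      then have "f \<otimes>\<^bsub>transducer_group T\<^esub> g = compose (lists (alphabet T)) f g"
        using Bij[OF comp.IH(1)] Bij[OF comp.IH(2)]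
        by (simp add: transducer_group_def BijGroup_def)
      with G.m_closed[OF comp.IH] show ?case
        by simp
    qed (rule state_map_in_group)
    then show ?thesis
      using finite_subset[OF _ fin] by (auto simp: finite_word_maps_iff)
  qed
qed

lemma stream_act_in_orbit:
  assumes u: "u \<in> streams (alphabet T)" and q: "q \<in> states T"
    and v: "v \<in> orbit (transducer_group T) (boundary_act T) u"
  shows "stream_act T q v \<in> orbit (transducer_group T) (boundary_act T) u"
proof -
  interpret group_action "transducer_group T" "streams (alphabet T)" "boundary_act T"
    by (rule group_action_boundary)
  interpret G: group "transducer_group T" by (rule group_transducer_group)
  obtain g where g: "g \<in> carrier (transducer_group T)" and v: "v = boundary_act T g u"
    using v by (auto simp: orbit_def)
  have "v \<in> streams (alphabet T)"
    using g u transducer_group_tree_aut unfolding v by (intro boundary_act_in_streams) auto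
  then have "stream_act T q v = boundary_act T (state_map T q) v"
    by (simp add: boundary_act_state_map q)
  also have "\<dots> = boundary_act T (state_map T q \<otimes>\<^bsub>transducer_group T\<^esub> g) u"
    unfolding v by (simp add: composition_rule u g q state_map_in_group)
  finally show ?thesis
    using g q by (auto simp: orbit_def state_map_in_group)
qed

text \<open>
  The orbits are invariant sets of bounded size, so words over the states induce only finitely many
  maps on infinite words. Every finite word is a prefix of an infinite one, so these maps determine
  the maps on finite words.
\<close>

lemma finite_word_maps_if_bounded_orbits:
  assumes bound: "\<And>u. u \<in> streams (alphabet T) \<Longrightarrow>
      finite (orbit (transducer_group T) (boundary_act T) u) \<and>
      card (orbit (transducer_group T) (boundary_act T) u) \<le> n"
  shows "finite (word_maps T)"
  unfolding word_maps_def
proof (rule finite_image_if_determined)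
  let ?A = "alphabet T"
  interpret group_action "transducer_group T" "streams ?A" "boundary_act T"
    by (rule group_action_boundary)
  show "finite ((\<lambda>ws. restrict (fold (stream_act T) ws) (streams ?A)) ` lists (states T))"
  proof (rule finite_word_actions_if_bounded_invariant_sets[OF finite_states])
    fix u assume u: "u \<in> streams ?A"
    show "\<exists>Y. u \<in> Y \<and> finite Y \<and> card Y \<le> n \<and> (\<forall>q \<in> states T. \<forall>y \<in> Y. stream_act T q y \<in> Y)"
      using bound[OF u] orbit_refl[OF u] stream_act_in_orbit[OF u]
      by (intro exI[of _ "orbit (transducer_group T) (boundary_act T) u"]) blast
  qed
  fix vs ws
  assume eq: "restrict (fold (stream_act T) vs) (streams ?A)
      = restrict (fold (stream_act T) ws) (streams ?A)"
  have stake: "stake k (fold (stream_act T) us x) = fold (word_act T) us (stake k x)" for k us x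
    by (induction us arbitrary: x) (simp_all add: stake_stream_act)
  have "fold (word_act T) vs u = fold (word_act T) ws u" if u: "u \<in> lists ?A" for u
  proof (cases u)
    case Nil
    then show ?thesis
      by (simp add: fold_word_act_Nil)
  next
    case (Cons a u')
    \<comment> \<open>Any infinite continuation of \<open>u\<close> over the alphabet will do.\<close>
    define x where "x = u @- sconst a"
    have "sset x \<subseteq> ?A"
      using u Cons by (auto simp: x_def)
    then have "x \<in> streams ?A"
      by (simp add: streams_iff_sset)
    then have "fold (stream_act T) vs x = fold (stream_act T) ws x"
      using fun_cong[OF eq, of x] by simp
    moreover have "stake (length u) x = u"
      by (simp add: x_def stake_shift)
    ultimately show ?thesis
      by (metis stake)
  qed
  then show "word_map T vs = word_map T ws"
    unfolding word_map_def by (intro restrict_ext)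
qed

lemma bounded_orbits_if_finite_group:
  assumes "finite (carrier (transducer_group T))"
  shows "finite (orbit (transducer_group T) (boundary_act T) u) \<and>
    card (orbit (transducer_group T) (boundary_act T) u) \<le> card (carrier (transducer_group T))"
proof -
  have "orbit (transducer_group T) (boundary_act T) u
      = (\<lambda>g. boundary_act T g u) ` carrier (transducer_group T)"
    by (auto simp: orbit_def)
  then show ?thesis
    using assms by (simp add: card_image_le)
qed

lemma finite_card_verts_boundary_schreier_graph:
  assumes "u \<in> streams (alphabet T)"
  shows "finite (verts (boundary_schreier_graph T u)) \<longleftrightarrow>
      finite (orbit (transducer_group T) (boundary_act T) u)"
    and "card (verts (boundary_schreier_graph T u)) =
      card (orbit (transducer_group T) (boundary_act T) u)"
  using boundary_schreier_graph_verts[OF assms] bij_betw_finite bij_betw_same_card by metis+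

end

theorem corollary1:
  fixes T :: "('q, 'a) pre_transducer"
  assumes "invertible_transducer T"
  shows "(finite (carrier (transducer_group T)) \<longleftrightarrow> finite (transducer_semigroup (dual T))) \<and>
    (finite (transducer_semigroup (dual T)) \<longleftrightarrow>
      (\<exists>n::nat. \<forall>u \<in> streams (alphabet T).
         finite (verts (boundary_schreier_graph T u)) \<and>
         card (verts (boundary_schreier_graph T u)) \<le> n))"
proof -
  interpret invertible_transducer T by fact
  interpret D: transducer "dual T" by (rule transducer_dual)
  have "finite (transducer_semigroup (dual T)) \<longleftrightarrow> finite (word_maps T)"
    by (simp add: finite_dual_word_maps_iff flip: D.finite_word_maps_iff)
  moreover have "(\<exists>n. \<forall>u \<in> streams (alphabet T).
         finite (verts (boundary_schreier_graph T u)) \<and>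
         card (verts (boundary_schreier_graph T u)) \<le> n) \<longleftrightarrow> finite (word_maps T)"
    (is "(\<exists>n. \<forall>u \<in> _. ?bounded u n) \<longleftrightarrow> _")
  proof
    assume "\<exists>n. \<forall>u \<in> streams (alphabet T). ?bounded u n"
    then obtain n where "\<forall>u \<in> streams (alphabet T). ?bounded u n"
      by blast
    then show "finite (word_maps T)"
      by (intro finite_word_maps_if_bounded_orbits[of n])
        (simp add: finite_card_verts_boundary_schreier_graph)
  next
    assume "finite (word_maps T)"
    then have "finite (carrier (transducer_group T))"
      by (simp add: finite_group_iff_finite_word_maps)
    then have "\<forall>u \<in> streams (alphabet T). ?bounded u (card (carrier (transducer_group T)))"
      by (simp add: finite_card_verts_boundary_schreier_graph bounded_orbits_if_finite_group)
    then show "\<exists>n. \<forall>u \<in> streams (alphabet T). ?bounded u n"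
      by blast
  qed
  ultimately show ?thesis
    by (simp add: finite_group_iff_finite_word_maps)
qed

end
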